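(* Let $\mathcal{M}$ be a finite metric space, let $\Pi$ be a finite family of isometries (distance-preserving permutations) of $\mathcal{M}$ that acts transitively on $\mathcal{M}$, and let $C\subseteq\mathcal{M}$ be an $(\mathcal{M},K,t)$-code. Let $\Gamma$ be a positive integer such that for all $w,b\in\mathcal{M}$ there are at least $\Gamma$ elements $\pi\in\Pi$ with $\pi(w)=b$. Define $\mathsf{SS}(w)$: pick $b\in C$ uniformly at random, pick $\pi$ uniformly at random from $\{\pi\in\Pi:\pi(w)=b\}$, and output (a canonical description of) $\pi$. Define $\mathsf{Rec}(w',\pi)$: find the codeword $b'\in C$ closest to $\pi(w')$ and output $\pi^{-1}(b')$. Then for every $m$, $(\mathsf{SS},\mathsf{Rec})$ is an average-case $(\mathcal{M},\,m,\,m-\log|\Pi|+\log\Gamma+\log K,\,t)$-secure sketch. It is efficient if the operations on the code (sampling a codeword, decoding), as well as the operations on permutations ($\pi$ and $\pi^{-1}$), can be implemented efficiently.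
   Context: All logarithms are base 2. $\mathcal{M}$ carries an integer-valued distance $\mathsf{dis}$. $\Pi$ acts transitively if for all $a,b\in\mathcal{M}$ there is $\pi\in\Pi$ with $\pi(a)=b$. Each $\pi\in\Pi$ has a canonical description independent of how $\pi$ was chosen, so the number of possible outputs of $\mathsf{SS}$ is at most $|\Pi|$. An $(\mathcal{M},K,t)$-code is a subset $C\subseteq\mathcal{M}$ with $K$ elements such that for every $w\in\mathcal{M}$ there is at most one $c\in C$ with $\mathsf{dis}(w,c)\le t$. Average min-entropy: $\tilde{\mathbf{H}}_\infty(A\mid B)=-\log\big(\mathbb{E}_{b\leftarrow B}[\max_a\Pr[A=a\mid B=b]]\big)$. An average-case $(\mathcal{M},m,\tilde m,t)$-secure sketch is a pair of randomized procedures: $\mathsf{SS}$ maps $w\in\mathcal{M}$ to a bit string; $\mathsf{Rec}$ takes $w'\in\mathcal{M}$ and a bit string; correctness: if $\mathsf{dis}(w,w')\le t$ then $\mathsf{Rec}(w',\mathsf{SS}(w))=w$; security: for any random variables $W$ over $\mathcal{M}$ and $I$ over $\{0,1\}^*$ with $\tilde{\mathbf{H}}_\infty(W\mid I)\ge m$, $\tilde{\mathbf{H}}_\infty(W\mid(\mathsf{SS}(W),I))\ge\tilde m$ (the coins of $\mathsf{SS}$ being independent of $(W,I)$). It is efficient if $\mathsf{SS}$ and $\mathsf{Rec}$ run in expected polynomial time.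
   Formalization: For efficiency, the operations on permutations assumed efficient include picking a uniformly random π with π(w)=b, besides π and π⁻¹; without this SS can fail to be efficient, e.g. when descriptions of permutations are easy to evaluate but infeasible to find. *)

theory Defs
  imports
    "HOL-Probability.Probability"
    "HOL-Analysis.Abstract_Metric_Spaces"
    "HOL-Combinatorics.Permutations"
    "HOL-Computational_Algebra.Polynomial"

begin

section \<open>Codes and isometries\<close>

definition is_code :: "'a set \<Rightarrow> ('a \<Rightarrow> 'a \<Rightarrow> real) \<Rightarrow> nat \<Rightarrow> real \<Rightarrow> 'a set \<Rightarrow> bool" where
  "is_code M d K t C \<longleftrightarrow>
     C \<subseteq> M \<and> card C = K \<and> (\<forall>w\<in>M. \<exists>\<^sub>\<le>\<^sub>1c. c \<in> C \<and> d w c \<le> t)"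

text \<open>
  \<^const>\<open>permutes\<close> makes an isometry the identity outside \<open>M\<close>, so that isometries that agree
  on \<open>M\<close> are equal and cardinalities of families of isometries of \<open>M\<close> are the intended ones.
\<close>

definition isometries :: "'a set \<Rightarrow> ('a \<Rightarrow> 'a \<Rightarrow> real) \<Rightarrow> ('a \<Rightarrow> 'a) set" where
  "isometries M d = {\<pi>. \<pi> permutes M \<and> (\<forall>x\<in>M. \<forall>y\<in>M. d (\<pi> x) (\<pi> y) = d x y)}"

definition acts_transitively :: "('a \<Rightarrow> 'a) set \<Rightarrow> 'a set \<Rightarrow> bool" where
  "acts_transitively F M \<longleftrightarrow> (\<forall>a\<in>M. \<forall>b\<in>M. \<exists>\<pi>\<in>F. \<pi> a = b)"

section \<open>Average min-entropy and secure sketches\<close>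

text \<open>
  The argument is the joint distribution of \<open>(A, B)\<close>. The supremum is a maximum, since a
  discrete distribution has a most likely outcome.
\<close>

definition avg_min_entropy :: "('a \<times> 'b) pmf \<Rightarrow> real" where
  "avg_min_entropy p =
     - log 2 (measure_pmf.expectation (map_pmf snd p)
         (\<lambda>b. SUP a. \<P>(x in measure_pmf p. fst x = a \<bar> snd x = b)))"

text \<open>
  In the security condition, \<open>p\<close> is the joint distribution of \<open>(W, I)\<close>; the sketch is drawn
  from \<open>SS w\<close> with coins that are independent of \<open>(W, I)\<close>.
\<close>

definition avg_secure_sketch ::
  "'a set \<Rightarrow> ('a \<Rightarrow> 'a \<Rightarrow> real) \<Rightarrow> real \<Rightarrow> real \<Rightarrow> real
    \<Rightarrow> ('a \<Rightarrow> bool list pmf) \<Rightarrow> ('a \<Rightarrow> bool list \<Rightarrow> 'a pmf) \<Rightarrow> bool" where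
  "avg_secure_sketch M d m m' t SS Rec \<longleftrightarrow>
     (\<forall>w\<in>M. \<forall>w'\<in>M. d w w' \<le> t \<longrightarrow> bind_pmf (SS w) (\<lambda>s. Rec w' s) = return_pmf w) \<and>
     (\<forall>p :: ('a \<times> bool list) pmf.
        fst ` set_pmf p \<subseteq> M \<longrightarrow> avg_min_entropy p \<ge> m \<longrightarrow>
        avg_min_entropy (bind_pmf p (\<lambda>(w, i). map_pmf (\<lambda>s. (w, (s, i))) (SS w))) \<ge> m')"

section \<open>The sketch built from a transitive family of isometries\<close>

text \<open>
  \<open>desc\<close> is the canonical description of an isometry as a bit string. \<open>dec x\<close> is a codeword
  closest to \<open>x\<close>; since there may be several when \<open>x\<close> is far from the code, it is a parameter
  constrained by \<open>nearest_codeword\<close>.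
\<close>

definition nearest_codeword ::
  "'a set \<Rightarrow> ('a \<Rightarrow> 'a \<Rightarrow> real) \<Rightarrow> 'a set \<Rightarrow> ('a \<Rightarrow> 'a) \<Rightarrow> bool" where
  "nearest_codeword M d C dec \<longleftrightarrow> (\<forall>x\<in>M. is_arg_min (d x) (\<lambda>c. c \<in> C) (dec x))"

definition perm_SS ::
  "('a \<Rightarrow> 'a) set \<Rightarrow> (('a \<Rightarrow> 'a) \<Rightarrow> bool list) \<Rightarrow> 'a set \<Rightarrow> 'a \<Rightarrow> bool list pmf" where
  "perm_SS F desc C w =
     do { b \<leftarrow> pmf_of_set C;
          \<pi> \<leftarrow> pmf_of_set {\<pi> \<in> F. \<pi> w = b};
          return_pmf (desc \<pi>) }"

definition perm_Rec ::
  "('a \<Rightarrow> 'a) set \<Rightarrow> (('a \<Rightarrow> 'a) \<Rightarrow> bool list) \<Rightarrow> ('a \<Rightarrow> 'a) \<Rightarrow> 'a \<Rightarrow> bool list \<Rightarrow> 'a pmf" where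
  "perm_Rec F desc dec w' s =
     (let \<pi> = inv_into F desc s in return_pmf (inv \<pi> (dec (\<pi> w'))))"

section \<open>Expected polynomial time\<close>

text \<open>
  The machine model: programs with fair coins over finitely many registers, each of which holds
  a bit string used as a stack. A register test, a push, a pop or a coin flip costs one step.
  \<open>Call r args c\<close> runs \<open>c\<close> on a fresh store that contains copies of the registers \<open>args\<close> and
  moves the contents of its register 0 to \<open>r\<close>. It costs one step plus the number of bits that
  are copied; moving the result is not charged separately, because the result is no longer than
  the copied arguments and the steps of \<open>c\<close> together. Procedures are not recursive, so
  calls can be expanded statically and the model is polynomially equivalent to multitape Turing
  machines with coins.
\<close>

type_synonym store = "nat \<Rightarrow> bool list"

datatype test = Nonempty nat | Top nat

datatype prog =
    Skip
  | Push bool nat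
  | Pop nat
  | Flip nat
  | Seq prog prog
  | If test prog prog
  | While test prog
  | Call nat "nat list" prog

fun holds :: "test \<Rightarrow> store \<Rightarrow> bool" where
  "holds (Nonempty r) s \<longleftrightarrow> s r \<noteq> []"
| "holds (Top r) s \<longleftrightarrow> s r \<noteq> [] \<and> hd (s r)"

definition store_of :: "bool list list \<Rightarrow> store" where
  "store_of xs = (\<lambda>i. if i < length xs then xs ! i else [])"

text \<open>
  A run yields the final store together with the number of steps; the missing probability mass
  of the subprobability distribution is the probability of divergence.
\<close>

definition after :: "nat \<Rightarrow> ('s \<times> nat) spmf \<Rightarrow> ('s \<times> nat) spmf" where
  "after n = map_spmf (\<lambda>(s, t). (s, n + t))"

definition seq_run ::
  "('s \<times> nat) spmf \<Rightarrow> ('s \<Rightarrow> ('s \<times> nat) spmf) \<Rightarrow> ('s \<times> nat) spmf" where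
  "seq_run p f = bind_spmf p (\<lambda>(s, t). after t (f s))"

text \<open>
  \<open>while_upto n b f\<close> is the part of the runs of a loop that leave it within \<open>n\<close> tests of the
  guard. It increases with \<open>n\<close>, and the loop is its least upper bound.
\<close>

primrec while_upto ::
  "nat \<Rightarrow> ('s \<Rightarrow> bool) \<Rightarrow> ('s \<Rightarrow> ('s \<times> nat) spmf) \<Rightarrow> 's \<Rightarrow> ('s \<times> nat) spmf" where
  "while_upto 0 b f s = return_pmf None"
| "while_upto (Suc n) b f s =
     after 1 (if b s then seq_run (f s) (while_upto n b f) else return_spmf (s, 0))"

primrec run :: "prog \<Rightarrow> store \<Rightarrow> (store \<times> nat) spmf" where
  "run Skip s = return_spmf (s, 0)"
| "run (Push x r) s = return_spmf (s(r := x # s r), 1)"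
| "run (Pop r) s = return_spmf (s(r := tl (s r)), 1)"
| "run (Flip r) s = map_spmf (\<lambda>x. (s(r := x # s r), 1)) coin_spmf"
| "run (Seq c1 c2) s = seq_run (run c1 s) (run c2)"
| "run (If b c1 c2) s = after 1 (if holds b s then run c1 s else run c2 s)"
| "run (While b c) s = lub_spmf (range (\<lambda>n. while_upto n (holds b) (run c) s))"
| "run (Call r args c) s =
     after (1 + sum_list (map (\<lambda>a. length (s a)) args))
       (map_spmf (\<lambda>(s', t). (s(r := s' 0), t)) (run c (store_of (map s args))))"

text \<open>
  A randomized task has, for each value \<open>k\<close> of the size parameter, a set \<open>Inst k\<close> of instances.
  An instance \<open>i\<close> is presented as the list of bit strings \<open>inp k i\<close>, preceded by \<open>k\<close> in unary, and
  the answer has to have exactly the distribution \<open>out k i\<close> (in particular, the program halts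
  with probability one). One program serves all \<open>k\<close>, and its expected number of steps is
  bounded, on every instance, by a polynomial in the total length of the input.
\<close>

definition efficient ::
  "(nat \<Rightarrow> 'i set) \<Rightarrow> (nat \<Rightarrow> 'i \<Rightarrow> bool list list) \<Rightarrow> (nat \<Rightarrow> 'i \<Rightarrow> bool list pmf) \<Rightarrow> bool" where
  "efficient Inst inp out \<longleftrightarrow>
     (\<exists>(c :: prog) (q :: nat poly). \<forall>k. \<forall>i\<in>Inst k.
        let xs = replicate k True # inp k i;
            R = run c (store_of xs)
        in map_spmf (\<lambda>(s, t). s 0) R = spmf_of_pmf (out k i) \<and>
           (\<integral>\<^sup>+ (s, t). of_nat t \<partial>measure_spmf R) \<le> of_nat (poly q (sum_list (map length xs))))"

text \<open>
  Points of the \<open>k\<close>-th space are represented by distinct bit strings of length polynomial in \<open>k\<close>.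
\<close>

definition poly_encoding :: "(nat \<Rightarrow> 'a set) \<Rightarrow> (nat \<Rightarrow> 'a \<Rightarrow> bool list) \<Rightarrow> bool" where
  "poly_encoding M enc \<longleftrightarrow>
     (\<forall>k. inj_on (enc k) (M k)) \<and>
     (\<exists>q :: nat poly. \<forall>k. \<forall>x\<in>M k. length (enc k x) \<le> poly q k)"

text \<open>The recovery procedure is run on points and on strings that are sketches of points.\<close>

definition efficient_sketch ::
  "(nat \<Rightarrow> 'a set) \<Rightarrow> (nat \<Rightarrow> 'a \<Rightarrow> bool list)
    \<Rightarrow> (nat \<Rightarrow> 'a \<Rightarrow> bool list pmf) \<Rightarrow> (nat \<Rightarrow> 'a \<Rightarrow> bool list \<Rightarrow> 'a pmf) \<Rightarrow> bool" where
  "efficient_sketch M enc SS Rec \<longleftrightarrow>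
     efficient M (\<lambda>k w. [enc k w]) SS \<and>
     efficient (\<lambda>k. M k \<times> (\<Union>w\<in>M k. set_pmf (SS k w)))
       (\<lambda>k (w', s). [enc k w', s]) (\<lambda>k (w', s). map_pmf (enc k) (Rec k w' s))"

definition efficient_code_ops ::
  "(nat \<Rightarrow> 'a set) \<Rightarrow> (nat \<Rightarrow> 'a \<Rightarrow> bool list) \<Rightarrow> (nat \<Rightarrow> 'a set) \<Rightarrow> (nat \<Rightarrow> 'a \<Rightarrow> 'a) \<Rightarrow> bool" where
  "efficient_code_ops M enc C dec \<longleftrightarrow>
     efficient (\<lambda>k. UNIV :: unit set) (\<lambda>k _. []) (\<lambda>k _. map_pmf (enc k) (pmf_of_set (C k))) \<and>
     efficient M (\<lambda>k x. [enc k x]) (\<lambda>k x. return_pmf (enc k (dec k x)))"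

text \<open>
  Besides the evaluation of \<open>\<pi>\<close> and its inverse, the operations on permutations include the
  selection of a uniformly random \<open>\<pi>\<close> that maps a given point to a given codeword.
\<close>

definition efficient_perm_ops ::
  "(nat \<Rightarrow> 'a set) \<Rightarrow> (nat \<Rightarrow> 'a \<Rightarrow> bool list) \<Rightarrow> (nat \<Rightarrow> 'a set)
    \<Rightarrow> (nat \<Rightarrow> ('a \<Rightarrow> 'a) set) \<Rightarrow> (nat \<Rightarrow> ('a \<Rightarrow> 'a) \<Rightarrow> bool list) \<Rightarrow> bool" where
  "efficient_perm_ops M enc C F desc \<longleftrightarrow>
     efficient (\<lambda>k. M k \<times> C k) (\<lambda>k (w, b). [enc k w, enc k b])
       (\<lambda>k (w, b). map_pmf (desc k) (pmf_of_set {\<pi> \<in> F k. \<pi> w = b})) \<and>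
     efficient (\<lambda>k. F k \<times> M k) (\<lambda>k (\<pi>, x). [desc k \<pi>, enc k x])
       (\<lambda>k (\<pi>, x). return_pmf (enc k (\<pi> x))) \<and>
     efficient (\<lambda>k. F k \<times> M k) (\<lambda>k (\<pi>, x). [desc k \<pi>, enc k x])
       (\<lambda>k (\<pi>, x). return_pmf (enc k (inv \<pi> x)))"

end

theory Submission
  imports Defs
begin

text \<open>
  Given \<open>w\<close>, every sketch value has probability at most \<open>1 / (K \<Gamma>)\<close>, and there are at most
  \<open>|\<Pi>|\<close> sketch values. Seeing the sketch therefore multiplies the adversary's optimal guessing
  probability by at most \<open>|\<Pi>| / (K \<Gamma>)\<close>. Recovery works because \<open>\<pi>(w')\<close> is within distance \<open>t\<close>
  of the codeword \<open>\<pi>(w)\<close>, which is then the only nearest codeword. Both procedures are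
  compositions of two, respectively three, of the given operations; since all intermediate points
  have encodings of length polynomial in \<open>k\<close>, the expected running times add up to a polynomial.
\<close>

subsection \<open>Entropy loss and correctness\<close>

lemma cond_prob_pmf_le_1: "cond_prob (measure_pmf p) P Q \<le> 1"
proof -
  have "measure_pmf.prob p {x. P x \<and> Q x} \<le> measure_pmf.prob p {x. Q x}"
    by (intro measure_pmf.finite_measure_mono) auto
  then show ?thesis
    by (auto simp: cond_prob_def divide_le_eq_1 less_le measure_nonneg)
qed

lemma cond_prob_pmf_nonneg: "0 \<le> cond_prob (measure_pmf p) P Q"
  by (simp add: cond_prob_def)

lemma SUP_cond_prob_pmf_bounds:
  "0 \<le> (SUP a. cond_prob (measure_pmf p) (P a) Q)" "(SUP a. cond_prob (measure_pmf p) (P a) Q) \<le> 1"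
proof -
  show "0 \<le> (SUP a. cond_prob (measure_pmf p) (P a) Q)"
    by (rule cSUP_upper2[where x = undefined])
       (auto intro!: bdd_aboveI[of _ 1] simp: cond_prob_pmf_nonneg cond_prob_pmf_le_1)
  show "(SUP a. cond_prob (measure_pmf p) (P a) Q) \<le> 1"
    by (rule cSUP_least) (auto simp: cond_prob_pmf_le_1)
qed

text \<open>Averaging over \<open>b\<close> multiplies by the probability of \<open>b\<close>, which
  cancels the conditioning and leaves a sum of largest joint probabilities. Over
  \<open>ennreal\<close> this sum needs no summability argument, although the range of
  \<open>b\<close> may be infinite.\<close>

lemma ennreal_expectation_guess:
  fixes p :: "('a \<times> 'b) pmf"
  shows "ennreal (measure_pmf.expectation (map_pmf snd p)
           (\<lambda>b. SUP a. \<P>(x in measure_pmf p. fst x = a \<bar> snd x = b))) =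
         (\<integral>\<^sup>+ b. (SUP a. ennreal (pmf p (a, b))) \<partial>count_space UNIV)"
proof -
  define g where "g a b = \<P>(x in measure_pmf p. fst x = a \<bar> snd x = b)" for a b
  have pmf_snd: "pmf (map_pmf snd p) b = measure_pmf.prob p {x. snd x = b}" for b
    by (simp add: pmf_map vimage_def)
  have joint: "measure_pmf.prob p {x. fst x = a \<and> snd x = b} = pmf p (a, b)" for a b
  proof -
    have "{x. fst x = a \<and> snd x = b} = {(a, b)}" by auto
    then show ?thesis by (simp add: measure_pmf_single)
  qed
  have g: "g a b = pmf p (a, b) / pmf (map_pmf snd p) b" for a b
    by (simp add: g_def cond_prob_def pmf_snd joint)
  have joint_le: "pmf p (a, b) \<le> pmf (map_pmf snd p) b" for a b
    unfolding pmf_snd joint[symmetric] by (intro measure_pmf.finite_measure_mono) auto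
  \<comment> \<open>If \<open>b\<close> has probability 0, the quotient is 0 by convention, but
    \<open>joint_le\<close> forces the joint probability to be 0 as well.\<close>
  have g_mult: "pmf (map_pmf snd p) b * g a b = pmf p (a, b)" for a b
    using joint_le[of a b] pmf_nonneg[of p "(a, b)"] by (auto simp: g)
  have g_nonneg: "0 \<le> g a b" and g_le: "g a b \<le> 1" for a b
    unfolding g_def by (rule cond_prob_pmf_nonneg cond_prob_pmf_le_1)+
  have sup_nonneg: "0 \<le> (SUP a. g a b)" and sup_le: "(SUP a. g a b) \<le> 1" for b
    unfolding g_def by (rule SUP_cond_prob_pmf_bounds)+
  have ennreal_sup: "ennreal (SUP a. g a b) = (SUP a. ennreal (g a b))" for b
  proof (rule ennreal_SUP)
    have "(SUP a. ennreal (g a b)) \<le> 1" using g_le by (auto intro!: SUP_least)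
    then show "(SUP a. ennreal (g a b)) \<noteq> \<top>" by (metis ennreal_one_neq_top top_unique)
  qed simp
  have "ennreal (measure_pmf.expectation (map_pmf snd p) (\<lambda>b. SUP a. g a b)) =
      (\<integral>\<^sup>+ b. ennreal (SUP a. g a b) \<partial>measure_pmf (map_pmf snd p))"
    using sup_nonneg sup_le
    by (intro nn_integral_eq_integral[symmetric] measure_pmf.integrable_const_bound[where B = 1]) auto
  also have "\<dots> = (\<integral>\<^sup>+ b. (SUP a. ennreal (pmf p (a, b))) \<partial>count_space UNIV)"
    unfolding nn_integral_measure_pmf ennreal_sup SUP_mult_left_ennreal
    by (simp add: ennreal_mult'[symmetric] g_nonneg g_mult)
  finally show ?thesis by (simp add: g_def)
qed

lemma avg_min_entropy_eq:
  "avg_min_entropy p = - log 2 (enn2real (\<integral>\<^sup>+ b. (SUP a. ennreal (pmf p (a, b))) \<partial>count_space UNIV))"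
  unfolding avg_min_entropy_def ennreal_expectation_guess[symmetric]
  by (subst enn2real_ennreal) (auto intro!: integral_nonneg_AE AE_pmfI SUP_cond_prob_pmf_bounds)

text \<open>One point of the support gives positivity; finiteness holds because the sum is the image
  of a real expectation. Both are needed to pass to \<open>enn2real\<close>, which sends \<top> to
  0, and to use monotonicity and additivity of the logarithm.\<close>

lemma guess_pos_finite:
  fixes p :: "('a \<times> 'b) pmf"
  shows "0 < (\<integral>\<^sup>+ b. (SUP a. ennreal (pmf p (a, b))) \<partial>count_space UNIV)"
    and "(\<integral>\<^sup>+ b. (SUP a. ennreal (pmf p (a, b))) \<partial>count_space UNIV) < \<top>"
proof -
  obtain a b where ab: "(a, b) \<in> set_pmf p" using set_pmf_not_empty[of p] by auto
  have "0 < ennreal (pmf p (a, b))" using ab by (simp add: pmf_positive)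
  also have "\<dots> \<le> (SUP a. ennreal (pmf p (a, b)))" by (rule SUP_upper) simp
  also have "\<dots> \<le> (\<integral>\<^sup>+ b. (SUP a. ennreal (pmf p (a, b))) \<partial>count_space UNIV)"
    by (rule nn_integral_ge_point) simp
  finally show "0 < \<dots>" .
qed (simp add: ennreal_expectation_guess[symmetric])

text \<open>A general leakage bound: for fixed \<open>(s, i)\<close> the largest joint probability
  grows by a factor of at most \<open>c\<close>, and summing over the possible sketches contributes
  the factor \<open>card S\<close>.\<close>

lemma avg_min_entropy_bind_ge:
  fixes p :: "('a \<times> 'b) pmf" and SS :: "'a \<Rightarrow> 'c pmf" and c :: real
  assumes S: "finite S" "\<And>w. w \<in> fst ` set_pmf p \<Longrightarrow> set_pmf (SS w) \<subseteq> S"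
    and c: "c > 0" "\<And>w s. w \<in> fst ` set_pmf p \<Longrightarrow> pmf (SS w) s \<le> c"
  shows "avg_min_entropy (bind_pmf p (\<lambda>(w, i). map_pmf (\<lambda>s. (w, (s, i))) (SS w)))
    \<ge> avg_min_entropy p - log 2 (card S * c)"
proof -
  define p' where "p' = bind_pmf p (\<lambda>(w, i). map_pmf (\<lambda>s. (w, (s, i))) (SS w))"
  define g where "g = (\<integral>\<^sup>+ b. (SUP a. ennreal (pmf p (a, b))) \<partial>count_space UNIV)"
  define g' where "g' = (\<integral>\<^sup>+ b. (SUP a. ennreal (pmf p' (a, b))) \<partial>count_space UNIV)"
  have pmf_p': "ennreal (pmf p' (w, (s, i))) = ennreal (pmf p (w, i)) * ennreal (pmf (SS w) s)" for w s i
  proof -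
    \<comment> \<open>The pairing keeps \<open>w\<close> and \<open>i\<close>, so only the outcome
      \<open>(w, i)\<close> of \<open>p\<close> can produce \<open>(w, (s, i))\<close>.\<close>
    have "ennreal (pmf (map_pmf (\<lambda>s. (fst x, (s, snd x))) (SS (fst x))) (w, (s, i))) =
        ennreal (pmf (SS w) s) * indicator {(w, i)} x" for x
    proof (cases "x = (w, i)")
      case True
      then show ?thesis
        using pmf_map_inj'[of "\<lambda>s. (w, (s, i))" "SS w" s] by (simp add: inj_on_def)
    next
      case False
      then have "(w, (s, i)) \<notin> (\<lambda>s. (fst x, (s, snd x))) ` set_pmf (SS (fst x))" by auto
      then show ?thesis using False by (simp add: pmf_map_outside)
    qed
    then show ?thesis
      unfolding p'_def ennreal_pmf_bind case_prod_unfold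
      by (simp add: nn_integral_cmult_indicator emeasure_pmf_single mult.commute)
  qed
  \<comment> \<open>The indicator confines the later sum over \<open>s\<close> to the finite set
    \<open>S\<close>. Off the support of \<open>p\<close> nothing is known about
    \<open>SS w\<close>, but there the left side is 0.\<close>
  have "ennreal (pmf p' (w, (s, i))) \<le> ennreal c * indicator S s * ennreal (pmf p (w, i))" for w s i
  proof (cases "(w, i) \<in> set_pmf p")
    case True
    then have w: "w \<in> fst ` set_pmf p" by force
    have "ennreal (pmf (SS w) s) \<le> ennreal c * indicator S s"
      using S(2)[OF w] c(2)[OF w, of s] by (cases "s \<in> S") (auto simp: set_pmf_iff intro: ennreal_leI)
    then show ?thesis
      unfolding pmf_p' by (subst mult.commute) (rule mult_right_mono, auto)
  qed (simp add: pmf_p' set_pmf_iff)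
  then have "(SUP w. ennreal (pmf p' (w, (s, i)))) \<le>
      (ennreal c * indicator S s) * (SUP w. ennreal (pmf p (w, i)))" for s i
    unfolding SUP_mult_left_ennreal by (intro SUP_mono) auto
  then have "g' \<le> (\<integral>\<^sup>+ (s, i). (ennreal c * indicator S s) *
      (SUP w. ennreal (pmf p (w, i))) \<partial>count_space UNIV)"
    unfolding g'_def by (intro nn_integral_mono) auto
  also have "\<dots> = (\<integral>\<^sup>+ s. (\<integral>\<^sup>+ i. (ennreal c * indicator S s) *
      (SUP w. ennreal (pmf p (w, i))) \<partial>count_space UNIV) \<partial>count_space UNIV)"
    by (subst nn_integral_fst_count_space[symmetric]) simp
  also have "\<dots> = (ennreal c * of_nat (card S)) * g"
    using S(1) by (simp add: nn_integral_cmult nn_integral_multc g_def)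
  finally have le: "g' \<le> ennreal (card S * c) * g"
    using c(1) by (simp add: ennreal_mult ennreal_of_nat_eq_real_of_nat mult.commute)
  have g: "0 < g" "g < \<top>" and g': "0 < g'" "g' < \<top>"
    unfolding g_def g'_def by (rule guess_pos_finite)+
  obtain w where w: "w \<in> fst ` set_pmf p" using set_pmf_not_empty[of p] by auto
  \<comment> \<open>The support of \<open>SS w\<close> is nonempty and lies in
    \<open>S\<close>.\<close>
  have "card S > 0" using S set_pmf_not_empty[of "SS w"] w by (force simp: card_gt_0_iff)
  then have cS: "card S * c > 0" using c by simp
  have real_le: "enn2real g' \<le> card S * c * enn2real g"
    using enn2real_mono[OF le] g cS by (simp add: enn2real_mult ennreal_mult_less_top)
  have "log 2 (enn2real g') \<le> log 2 (card S * c * enn2real g)"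
    using real_le g' by (intro log_mono) (auto simp: enn2real_positive_iff)
  also have "\<dots> = log 2 (card S * c) + log 2 (enn2real g)"
    using cS g by (intro log_mult_pos) (auto simp: enn2real_positive_iff)
  finally show ?thesis
    unfolding avg_min_entropy_eq p'_def[symmetric] g_def[symmetric] g'_def[symmetric] by simp
qed

section \<open>Output distribution of the sketch, and recovery\<close>

text \<open>Since \<open>desc\<close> is injective, a sketch determines \<pi> and hence the codeword
  \<open>\<pi> w\<close>. That codeword is drawn with probability \<open>1 / card C\<close>, and
  then \<pi> with probability at most \<open>1 / \<Gamma>\<close>.\<close>

lemma pmf_perm_SS_le:
  assumes "finite F" "inj_on desc F" "finite C" "C \<noteq> {}" "\<Gamma> > 0"
    and \<Gamma>: "\<And>b. b \<in> C \<Longrightarrow> card {\<pi> \<in> F. \<pi> w = b} \<ge> \<Gamma>"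
  shows "set_pmf (perm_SS F desc C w) \<subseteq> desc ` F"
    and "pmf (perm_SS F desc C w) s \<le> 1 / (real (card C) * real \<Gamma>)"
proof -
  define A where "A b = {\<pi> \<in> F. \<pi> w = b}" for b
  \<comment> \<open>Nonempty finite fibres are what gives \<open>pmf_of_set\<close> its intended
    meaning.\<close>
  have A: "finite (A b)" "A b \<noteq> {}" if "b \<in> C" for b
    using \<Gamma>[OF that] \<open>\<Gamma> > 0\<close> \<open>finite F\<close> by (auto simp: A_def[symmetric]) (simp add: A_def)
  have SS: "perm_SS F desc C w = bind_pmf (pmf_of_set C) (\<lambda>b. map_pmf desc (pmf_of_set (A b)))"
    by (simp add: perm_SS_def A_def map_pmf_def)
  show sub: "set_pmf (perm_SS F desc C w) \<subseteq> desc ` F"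
    using A assms by (auto simp: SS A_def)
  show "pmf (perm_SS F desc C w) s \<le> 1 / (real (card C) * real \<Gamma>)"
  proof (cases "s \<in> desc ` F")
    case False
    then have "pmf (perm_SS F desc C w) s = 0" using sub by (auto simp: pmf_eq_0_set_pmf)
    then show ?thesis by simp
  next
    case True
    then obtain \<pi> where \<pi>: "\<pi> \<in> F" "s = desc \<pi>" by auto
    have *: "pmf (map_pmf desc (pmf_of_set (A b))) s \<le> (if b = \<pi> w then 1 / real \<Gamma> else 0)"
      if b: "b \<in> C" for b
    proof -
      have "pmf (map_pmf desc (pmf_of_set (A b))) s = measure_pmf.prob (pmf_of_set (A b)) (desc -` {s})"
        by (rule pmf_map)
      also have "\<dots> = measure_pmf.prob (pmf_of_set (A b)) (desc -` {s} \<inter> A b)"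
        using measure_Int_set_pmf[of "pmf_of_set (A b)"] A[OF b] by simp
      also have "desc -` {s} \<inter> A b = (if b = \<pi> w then {\<pi>} else {})"
        using \<pi> \<open>inj_on desc F\<close> by (auto simp: A_def inj_on_def)
      also have "measure_pmf.prob (pmf_of_set (A b)) \<dots> \<le> (if b = \<pi> w then 1 / real \<Gamma> else 0)"
        using A[OF b] \<Gamma>[OF b, folded A_def] \<open>\<Gamma> > 0\<close>
        by (cases "b = \<pi> w") (simp_all add: measure_pmf_single indicator_def frac_le)
      finally show ?thesis .
    qed
    have "pmf (perm_SS F desc C w) s =
        (\<Sum>b\<in>C. pmf (map_pmf desc (pmf_of_set (A b))) s) / real (card C)"
      unfolding SS using assms by (subst pmf_bind_pmf_of_set) auto
    also have "\<dots> \<le> (\<Sum>b\<in>C. if b = \<pi> w then 1 / real \<Gamma> else 0) / real (card C)"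
      using * by (intro divide_right_mono sum_mono) auto
    \<comment> \<open>At most one summand is nonzero; there is none if \<open>\<pi> w\<close> is not
      a codeword.\<close>
    also have "\<dots> \<le> (1 / real \<Gamma>) / real (card C)"
      using assms by (intro divide_right_mono) auto
    finally show ?thesis by (simp add: mult.commute)
  qed
qed

lemma perm_Rec_correct:
  assumes metric: "Metric_space M d" and F: "F \<subseteq> isometries M d" and desc: "inj_on desc F"
    and code: "is_code M d K t C" and dec: "nearest_codeword M d C dec"
    and \<pi>: "\<pi> \<in> F" "\<pi> w \<in> C" and w: "w \<in> M" "w' \<in> M" "d w w' \<le> t"
  shows "perm_Rec F desc dec w' (desc \<pi>) = return_pmf w"
proof -
  interpret Metric_space M d by (rule metric)
  have perm: "\<pi> permutes M" and iso: "d (\<pi> w') (\<pi> w) = d w' w"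
    using \<pi> F w by (auto simp: isometries_def)
  have \<pi>w': "\<pi> w' \<in> M" using perm w by (simp add: permutes_in_image)
  have near: "dec (\<pi> w') \<in> C" "d (\<pi> w') (dec (\<pi> w')) \<le> d (\<pi> w') (\<pi> w)"
    using dec \<pi>w' \<pi> by (auto simp: nearest_codeword_def is_arg_min_def not_less)
  \<comment> \<open>Both are codewords within distance \<open>t\<close> of \<open>\<pi> w'\<close>:
    the right one because \<pi> is an isometry, the left one because it is no farther away. The code
    admits at most one.\<close>
  have "dec (\<pi> w') = \<pi> w"
    using code \<pi>w' near \<pi> w iso commute[of w w'] by (auto simp: is_code_def Uniq_def)
  then show ?thesis
    using desc \<pi> perm by (simp add: perm_Rec_def permutes_inverses)
qed

lemma avg_secure_sketch_perm:
  assumes metric: "Metric_space M d" and finite_space: "finite M"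
    and F: "F \<subseteq> isometries M d" "finite F"
    and code: "is_code M d K t C" "K > 0"
    and \<Gamma>: "\<Gamma> > 0" "\<And>w b. w \<in> M \<Longrightarrow> b \<in> M \<Longrightarrow> card {\<pi> \<in> F. \<pi> w = b} \<ge> \<Gamma>"
    and desc: "inj_on desc F" and dec: "nearest_codeword M d C dec"
  shows "avg_secure_sketch M d m (m - log 2 (card F) + log 2 \<Gamma> + log 2 K) t
    (perm_SS F desc C) (perm_Rec F desc dec)"
  unfolding avg_secure_sketch_def
proof (intro conjI ballI allI impI)
  have C: "C \<subseteq> M" "card C = K" "finite C" "C \<noteq> {}"
    using code finite_space by (auto simp: is_code_def card_gt_0_iff)
  have card_A: "card {\<pi> \<in> F. \<pi> w = b} \<ge> \<Gamma>" if "w \<in> M" "b \<in> C" for w b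
    using \<Gamma>(2)[of w b] that C(1) by auto
  {
    fix w w' assume w: "w \<in> M" "w' \<in> M" "d w w' \<le> t"
    have "bind_pmf (perm_SS F desc C w) (perm_Rec F desc dec w') =
        bind_pmf (pmf_of_set C) (\<lambda>b. bind_pmf (pmf_of_set {\<pi> \<in> F. \<pi> w = b})
          (\<lambda>\<pi>. perm_Rec F desc dec w' (desc \<pi>)))"
      by (simp add: perm_SS_def bind_assoc_pmf bind_return_pmf)
    also have "\<dots> = bind_pmf (pmf_of_set C) (\<lambda>b. bind_pmf (pmf_of_set {\<pi> \<in> F. \<pi> w = b})
          (\<lambda>\<pi>. return_pmf w))"
    proof (intro bind_pmf_cong refl)
      fix b \<pi> assume "b \<in> set_pmf (pmf_of_set C)" and "\<pi> \<in> set_pmf (pmf_of_set {\<pi> \<in> F. \<pi> w = b})"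
      moreover from this have "b \<in> C" using C by simp
      \<comment> \<open>Without this, membership in the support of \<open>pmf_of_set\<close> would
        not give membership in the fibre.\<close>
      moreover have "{\<pi> \<in> F. \<pi> w = b} \<noteq> {}"
        using card_A[OF w(1) \<open>b \<in> C\<close>] \<Gamma>(1) by (metis card.empty leD)
      ultimately have "\<pi> \<in> F" "\<pi> w \<in> C" using F(2) by auto
      then show "perm_Rec F desc dec w' (desc \<pi>) = return_pmf w"
        using perm_Rec_correct[OF metric F(1) desc code(1) dec] w by blast
    qed
    finally show "bind_pmf (perm_SS F desc C w) (perm_Rec F desc dec w') = return_pmf w"
      by (simp add: bind_pmf_const)
  }
  fix p :: "('a \<times> bool list) pmf"
  assume p: "fst ` set_pmf p \<subseteq> M" and m: "m \<le> avg_min_entropy p"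
  define c where "c = 1 / (real K * real \<Gamma>)"
  have c: "c > 0" using \<Gamma>(1) code(2) by (simp add: c_def)
  obtain w where w: "w \<in> M" using C by auto
  \<comment> \<open>A fibre over a codeword already has \<Gamma> > 0 elements; positivity lets the
    logarithm be split.\<close>
  have "card F \<noteq> 0"
    using card_A[OF w] C \<Gamma>(1) F(2) by (auto simp: card_eq_0_iff)
  then have "log 2 (card (desc ` F) * c) = log 2 (card F) - log 2 \<Gamma> - log 2 K"
    using \<Gamma>(1) code(2) desc by (simp add: c_def card_image log_divide_pos log_mult_pos)
  moreover have "avg_min_entropy p - log 2 (card (desc ` F) * c) \<le>
      avg_min_entropy (bind_pmf p (\<lambda>(w, i). map_pmf (\<lambda>s. (w, (s, i))) (perm_SS F desc C w)))"
  proof (rule avg_min_entropy_bind_ge[OF _ _ \<open>c > 0\<close>])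
    fix w assume "w \<in> fst ` set_pmf p"
    then have "w \<in> M" using p by auto
    note SS = pmf_perm_SS_le[OF F(2) desc C(3,4) \<Gamma>(1) card_A[OF this]]
    show "set_pmf (perm_SS F desc C w) \<subseteq> desc ` F" by (rule SS(1))
    show "pmf (perm_SS F desc C w) s \<le> c" for s using SS(2) C(2) by (simp add: c_def)
  qed (use F(2) in auto)
  ultimately show "m - log 2 (card F) + log 2 \<Gamma> + log 2 K \<le>
      avg_min_entropy (bind_pmf p (\<lambda>(w, i). map_pmf (\<lambda>s. (w, (s, i))) (perm_SS F desc C w)))"
    using m by linarith
qed

subsection \<open>Expected running time\<close>

lemma poly_nat_mono:
  fixes q :: "nat poly"
  assumes "x \<le> y"
  shows "poly q x \<le> poly q y"
  using assms by (induction q) (auto intro!: add_mono mult_mono)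

text \<open>Diverging runs carry no mass here. The bound is meaningful because it is always paired
  with an output distribution of total mass one.\<close>

definition mean_steps :: "('s \<times> nat) spmf \<Rightarrow> ennreal" where
  "mean_steps R = (\<integral>\<^sup>+ (s, t). of_nat t \<partial>measure_spmf R)"

text \<open>Only an inequality, because \<open>n\<close> is weighted by the halting
  probability.\<close>

lemma mean_steps_after_le: "mean_steps (after n R) \<le> of_nat n + mean_steps R"
proof -
  have "mean_steps (after n R) = (\<integral>\<^sup>+ x. (of_nat n + of_nat (snd x)) \<partial>measure_spmf R)"
    by (simp add: mean_steps_def after_def o_def case_prod_unfold)
  also have "\<dots> = of_nat n * emeasure (measure_spmf R) UNIV + (\<integral>\<^sup>+ x. of_nat (snd x) \<partial>measure_spmf R)"
    by (subst nn_integral_add) (auto simp: space_measure_spmf)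
  also have "\<dots> \<le> of_nat n * 1 + mean_steps R"
    unfolding mean_steps_def case_prod_unfold
    by (intro add_mono mult_left_mono order_refl measure_spmf.subprob_emeasure_le_1) auto
  finally show ?thesis by simp
qed

text \<open>Linearity of expectation. The bound \<open>b\<close> is uniform over the reachable
  stores, so the random step count of the first part never enters the bound for the second.\<close>

lemma mean_steps_seq_run_le:
  assumes p: "mean_steps p \<le> a"
    and f: "\<And>s. s \<in> set_spmf (map_spmf fst p) \<Longrightarrow> mean_steps (f s) \<le> b"
  shows "mean_steps (seq_run p f) \<le> a + b"
proof -
  have "mean_steps (seq_run p f) =
      (\<integral>\<^sup>+ x. mean_steps (after (snd x) (f (fst x))) \<partial>measure_spmf p)"
    unfolding mean_steps_def seq_run_def measure_spmf_bind case_prod_unfold o_def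
    by (subst nn_integral_bind[where B = "count_space UNIV"])
       (auto intro!: measurableI simp: space_subprob_algebra)
  also have "\<dots> \<le> (\<integral>\<^sup>+ x. of_nat (snd x) + b \<partial>measure_spmf p)"
  proof (rule nn_integral_mono_AE, rule AE_measure_spmf_iff[THEN iffD2], intro ballI)
    fix x assume "x \<in> set_spmf p"
    then have "mean_steps (f (fst x)) \<le> b" by (intro f) auto
    then show "mean_steps (after (snd x) (f (fst x))) \<le> of_nat (snd x) + b"
      using mean_steps_after_le[of "snd x" "f (fst x)"] by (meson add_left_mono order_trans)
  qed
  also have "\<dots> = mean_steps p + b * emeasure (measure_spmf p) UNIV"
    unfolding mean_steps_def case_prod_unfold
    by (subst nn_integral_add) (auto simp: space_measure_spmf)
  also have "\<dots> \<le> a + b * 1"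
    by (intro add_mono p mult_left_mono measure_spmf.subprob_emeasure_le_1) auto
  finally show ?thesis by simp
qed

section \<open>Composition of programs with prescribed output distributions\<close>

definition computes :: "prog \<Rightarrow> bool list list \<Rightarrow> bool list pmf \<Rightarrow> nat \<Rightarrow> bool" where
  "computes c xs D T \<longleftrightarrow>
     map_spmf (\<lambda>(s, t). s 0) (run c (store_of xs)) = spmf_of_pmf D \<and>
     mean_steps (run c (store_of xs)) \<le> of_nat T"

text \<open>Unlike \<open>computes\<close>, this records the whole final store, so that a following
  command can read the other registers.\<close>

definition reaches :: "prog \<Rightarrow> store \<Rightarrow> store pmf \<Rightarrow> nat \<Rightarrow> bool" where
  "reaches c s D T \<longleftrightarrow> map_spmf fst (run c s) = spmf_of_pmf D \<and> mean_steps (run c s) \<le> of_nat T"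

lemma efficient_iff:
  "efficient Inst inp out \<longleftrightarrow>
     (\<exists>c q. \<forall>k. \<forall>i\<in>Inst k. computes c (replicate k True # inp k i) (out k i)
        (poly q (k + sum_list (map length (inp k i)))))"
  by (simp add: efficient_def computes_def mean_steps_def Let_def)

lemma efficient_prodD:
  assumes "efficient (\<lambda>k. A k \<times> B k) (\<lambda>k (x, y). [f k x y, g k x y]) (\<lambda>k (x, y). h k x y)"
  shows "\<exists>c q. \<forall>k. \<forall>x\<in>A k. \<forall>y\<in>B k.
    computes c [replicate k True, f k x y, g k x y] (h k x y) (poly q (k + (length (f k x y) + length (g k x y))))"
  using assms by (simp add: efficient_iff)

lemma computesI:
  assumes "reaches c (store_of xs) D T" and "out = map_pmf (\<lambda>s. s 0) D"
  shows "computes c xs out T"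
proof -
  have "map_spmf (\<lambda>(s, t). s 0) (run c (store_of xs)) =
      map_spmf (\<lambda>s. s 0) (map_spmf fst (run c (store_of xs)))"
    by (simp add: spmf.map_comp o_def case_prod_unfold)
  with assms show ?thesis by (simp add: computes_def reaches_def)
qed

text \<open>The callee works on copies, so the caller's store changes only at \<open>r\<close>.
  Writing the answer as \<open>e x\<close> with \<open>x\<close> drawn from \<open>B\<close> keeps
  the sampled object itself available to later steps.\<close>

lemma reaches_Call:
  assumes c: "computes c (map s args) (map_pmf e B) T"
    and T': "1 + sum_list (map (\<lambda>a. length (s a)) args) + T \<le> T'"
  shows "reaches (Call r args c) s (map_pmf (\<lambda>x. s(r := e x)) B) T'"
proof -
  define n where "n = 1 + sum_list (map (\<lambda>a. length (s a)) args)"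
  define R where "R = run c (store_of (map s args))"
  have run: "run (Call r args c) s = after n (map_spmf (\<lambda>(s', t). (s(r := s' 0), t)) R)"
    by (simp only: run.simps n_def R_def)
  have R: "map_spmf (\<lambda>(s, t). s 0) R = spmf_of_pmf (map_pmf e B)" "mean_steps R \<le> of_nat T"
    using c by (simp_all add: computes_def R_def)
  have "map_spmf fst (run (Call r args c) s) = map_spmf (\<lambda>v. s(r := v)) (map_spmf (\<lambda>(s, t). s 0) R)"
    unfolding run by (simp add: after_def spmf.map_comp o_def case_prod_unfold)
  also have "\<dots> = spmf_of_pmf (map_pmf (\<lambda>x. s(r := e x)) B)"
    unfolding R(1) by (simp add: pmf.map_comp o_def)
  finally have dist: "map_spmf fst (run (Call r args c) s) = \<dots>" .
  have "mean_steps (run (Call r args c) s) \<le>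
      of_nat n + mean_steps (map_spmf (\<lambda>(s', t). (s(r := s' 0), t)) R)"
    unfolding run by (rule mean_steps_after_le)
  also have "mean_steps (map_spmf (\<lambda>(s', t). (s(r := s' 0), t)) R) = mean_steps R"
    by (simp add: mean_steps_def o_def case_prod_unfold)
  also have "of_nat n + mean_steps R \<le> of_nat n + of_nat T"
    by (rule add_left_mono) (rule R(2))
  also have "\<dots> = of_nat (n + T)" by simp
  also have "\<dots> \<le> of_nat T'"
    by (rule of_nat_mono) (use T' in \<open>simp add: n_def\<close>)
  finally show ?thesis unfolding reaches_def using dist by blast
qed

text \<open>The second program is analysed for each outcome \<open>x\<close> of \<open>B\<close>
  rather than for each store, so its target \<open>D x\<close> can refer to the sampled
  object.\<close>

lemma reaches_Seq:
  assumes c1: "reaches c1 s (map_pmf g B) T1"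
    and c2: "\<And>x. x \<in> set_pmf B \<Longrightarrow> reaches c2 (g x) (D x) T2"
  shows "reaches (Seq c1 c2) s (bind_pmf B D) (T1 + T2)"
proof -
  have run1: "map_spmf fst (run c1 s) = spmf_of_pmf (map_pmf g B)" and "mean_steps (run c1 s) \<le> of_nat T1"
    using c1 unfolding reaches_def by blast+
  have run2: "map_spmf fst (run c2 (g x)) = spmf_of_pmf (D x)" "mean_steps (run c2 (g x)) \<le> of_nat T2"
    if "x \<in> set_pmf B" for x
    using c2[OF that] unfolding reaches_def by blast+
  have "map_spmf fst (run (Seq c1 c2) s) =
      bind_spmf (map_spmf fst (run c1 s)) (\<lambda>s'. map_spmf fst (run c2 s'))"
    by (simp add: seq_run_def after_def map_spmf_bind_spmf bind_map_spmf spmf.map_comp o_def case_prod_unfold)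
  also have "\<dots> = bind_pmf B (\<lambda>x. map_spmf fst (run c2 (g x)))"
    unfolding run1 bind_spmf_of_pmf by (rule bind_map_pmf)
  also have "\<dots> = bind_pmf B (\<lambda>x. spmf_of_pmf (D x))"
    by (rule bind_pmf_cong[OF refl run2(1)])
  also have "\<dots> = spmf_of_pmf (bind_pmf B D)"
    by (rule spmf_of_pmf_bind[symmetric])
  finally have dist: "map_spmf fst (run (Seq c1 c2) s) = \<dots>" .
  have "mean_steps (run (Seq c1 c2) s) \<le> of_nat T1 + of_nat T2"
    unfolding run.simps
  proof (rule mean_steps_seq_run_le)
    show "mean_steps (run c1 s) \<le> of_nat T1" by fact
    fix s' assume "s' \<in> set_spmf (map_spmf fst (run c1 s))"
    then obtain x where "x \<in> set_pmf B" "s' = g x" unfolding run1 by auto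
    then show "mean_steps (run c2 s') \<le> of_nat T2" using run2(2) by blast
  qed
  then show ?thesis unfolding reaches_def of_nat_add using dist by blast
qed

section \<open>Programs for the sketch and for recovery\<close>

lemma efficient_perm_SS:
  assumes enc: "poly_encoding M enc"
    and code_ops: "efficient_code_ops M enc C dec"
    and perm_ops: "efficient_perm_ops M enc C F desc"
    and C: "\<And>k. finite (C k)" "\<And>k. C k \<noteq> {}" "\<And>k. C k \<subseteq> M k"
  shows "efficient M (\<lambda>k w. [enc k w]) (\<lambda>k. perm_SS (F k) (desc k) (C k))"
proof -
  obtain c1 q1 where sample: "\<And>k.
      computes c1 [replicate k True] (map_pmf (enc k) (pmf_of_set (C k))) (poly q1 k)"
    using code_ops unfolding efficient_code_ops_def efficient_iff by auto
  obtain c2 q2 where select: "\<forall>k. \<forall>w\<in>M k. \<forall>b\<in>C k.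
      computes c2 [replicate k True, enc k w, enc k b] (map_pmf (desc k) (pmf_of_set {\<pi> \<in> F k. \<pi> w = b}))
        (poly q2 (k + (length (enc k w) + length (enc k b))))"
    using efficient_prodD[OF perm_ops[unfolded efficient_perm_ops_def, THEN conjunct1]] by blast
  obtain qe where qe: "\<And>k x. x \<in> M k \<Longrightarrow> length (enc k x) \<le> poly qe k"
    using enc unfolding poly_encoding_def by blast
  \<comment> \<open>Register 0 holds \<open>k\<close> in unary until the last call overwrites it
    with the answer; register 1 holds the encoded \<open>w\<close>, register 2 the sampled
    codeword.\<close>
  define c where "c = Seq (Call 2 [0] c1) (Call 0 [0, 1, 2] c2)"
  \<comment> \<open>At the input length, \<open>N\<close> bounds the arguments of each call: the
    input itself, through the identity polynomial \<open>[:0, 1:]\<close>, plus one intermediate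
    point. Each block of \<open>Q\<close> counts the call, the copying and the callee.\<close>
  define N where "N = [:0, 1:] + qe"
  define Q where "Q = ([:1:] + N + pcompose q1 N) + ([:1:] + N + pcompose q2 N)"
  have "computes c [replicate k True, enc k w] (perm_SS (F k) (desc k) (C k) w)
      (poly Q (k + length (enc k w)))" if w: "w \<in> M k" for k w
  proof (rule computesI)
    define L where "L = k + length (enc k w)"
    define s where "s = store_of [replicate k True, enc k w]"
    have s: "s 0 = replicate k True" "s (Suc 0) = enc k w" by (auto simp: s_def store_of_def)
    have kL: "k \<le> L" by (simp add: L_def)
    have poly_N: "poly N L = L + poly qe L" by (simp add: N_def)
    have poly_Q: "poly Q L = (1 + poly N L + poly q1 (poly N L)) + (1 + poly N L + poly q2 (poly N L))"
      by (simp add: Q_def poly_pcompose)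
    have "reaches c s (bind_pmf (pmf_of_set (C k)) (\<lambda>b. map_pmf (\<lambda>\<pi>. s(2 := enc k b, 0 := desc k \<pi>))
           (pmf_of_set {\<pi> \<in> F k. \<pi> w = b}))) (poly Q L)"
      unfolding c_def poly_Q
    proof (rule reaches_Seq)
      have "poly q1 k \<le> poly q1 (poly N L)"
        using kL poly_N by (intro poly_nat_mono) simp
      then show "reaches (Call 2 [0] c1) s (map_pmf (\<lambda>b. s(2 := enc k b)) (pmf_of_set (C k)))
          (1 + poly N L + poly q1 (poly N L))"
        using kL poly_N sample[of k] by (intro reaches_Call[where T = "poly q1 k"]) (auto simp: s)
    next
      fix b assume "b \<in> set_pmf (pmf_of_set (C k))"
      then have b: "b \<in> C k" using C by simp
      then have "b \<in> M k" using C(3)[of k] by blast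
      have "length (enc k b) \<le> poly qe L"
        using qe[OF \<open>b \<in> M k\<close>] poly_nat_mono[OF kL, of qe] by (rule order_trans)
      then have le: "k + (length (enc k w) + length (enc k b)) \<le> poly N L"
        unfolding poly_N by (simp add: L_def)
      show "reaches (Call 0 [0, 1, 2] c2) (s(2 := enc k b))
          (map_pmf (\<lambda>\<pi>. s(2 := enc k b, 0 := desc k \<pi>)) (pmf_of_set {\<pi> \<in> F k. \<pi> w = b}))
          (1 + poly N L + poly q2 (poly N L))"
        using le poly_nat_mono[OF le, of q2] select w b
        by (intro reaches_Call) (auto simp: s)
    qed
    then show "reaches c (store_of [replicate k True, enc k w])
        (bind_pmf (pmf_of_set (C k)) (\<lambda>b. map_pmf (\<lambda>\<pi>. s(2 := enc k b, 0 := desc k \<pi>))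
           (pmf_of_set {\<pi> \<in> F k. \<pi> w = b}))) (poly Q (k + length (enc k w)))"
      by (simp add: s_def L_def)
  qed (simp add: perm_SS_def map_bind_pmf pmf.map_comp o_def map_pmf_def[symmetric])
  then show ?thesis
    unfolding efficient_iff by auto
qed

text \<open>The closure assumptions on \<open>dec\<close> and \<open>F\<close> keep the intermediate
  points in \<open>M k\<close>, where the given operations apply and encodings are short. The
  assumption on \<open>S\<close> makes every string received a description of some \<pi> in the
  family.\<close>

lemma efficient_perm_Rec:
  assumes enc: "poly_encoding M enc"
    and code_ops: "efficient_code_ops M enc C dec"
    and perm_ops: "efficient_perm_ops M enc C F desc"
    and desc: "\<And>k. inj_on (desc k) (F k)"
    and dec: "\<And>k x. x \<in> M k \<Longrightarrow> dec k x \<in> M k"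
    and F: "\<And>k \<pi> x. \<pi> \<in> F k \<Longrightarrow> x \<in> M k \<Longrightarrow> \<pi> x \<in> M k"
    and S: "\<And>k. S k \<subseteq> desc k ` F k"
  shows "efficient (\<lambda>k. M k \<times> S k) (\<lambda>k (w', s). [enc k w', s])
     (\<lambda>k (w', s). map_pmf (enc k) (perm_Rec (F k) (desc k) (dec k) w' s))"
proof -
  obtain c1 q1 where eval: "\<forall>k. \<forall>\<pi>\<in>F k. \<forall>x\<in>M k.
      computes c1 [replicate k True, desc k \<pi>, enc k x] (return_pmf (enc k (\<pi> x)))
        (poly q1 (k + (length (desc k \<pi>) + length (enc k x))))"
    using efficient_prodD[OF perm_ops[unfolded efficient_perm_ops_def, THEN conjunct2, THEN conjunct1]] by blast
  obtain c2 q2 where decode: "\<forall>k. \<forall>x\<in>M k.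
      computes c2 [replicate k True, enc k x] (return_pmf (enc k (dec k x)))
        (poly q2 (k + length (enc k x)))"
    using code_ops unfolding efficient_code_ops_def efficient_iff by auto
  obtain c3 q3 where inverse: "\<forall>k. \<forall>\<pi>\<in>F k. \<forall>x\<in>M k.
      computes c3 [replicate k True, desc k \<pi>, enc k x] (return_pmf (enc k (inv \<pi> x)))
        (poly q3 (k + (length (desc k \<pi>) + length (enc k x))))"
    using efficient_prodD[OF perm_ops[unfolded efficient_perm_ops_def, THEN conjunct2, THEN conjunct2]] by blast
  obtain qe where qe: "\<And>k x. x \<in> M k \<Longrightarrow> length (enc k x) \<le> poly qe k"
    using enc unfolding poly_encoding_def by blast
  \<comment> \<open>Registers 1 and 2 hold the point and the sketch, 3 its image under \<pi>, 4 the
    decoded codeword. The permutation operations take the description first, hence the order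
    \<open>0, 2, 1\<close>.\<close>
  define c where "c = Seq (Call 3 [0, 2, 1] c1) (Seq (Call 4 [0, 3] c2) (Call 0 [0, 2, 4] c3))"
  define N where "N = [:0, 1:] + qe"
  define Q where "Q = ([:1:] + N + pcompose q1 N) +
     (([:1:] + N + pcompose q2 N) + ([:1:] + N + pcompose q3 N))"
  have "computes c [replicate k True, enc k x, desc k \<pi>] (return_pmf (enc k (inv \<pi> (dec k (\<pi> x)))))
      (poly Q (k + (length (enc k x) + length (desc k \<pi>))))"
    if \<pi>: "\<pi> \<in> F k" and x: "x \<in> M k" for k \<pi> x
  proof (rule computesI)
    define L where "L = k + (length (enc k x) + length (desc k \<pi>))"
    define s where "s = store_of [replicate k True, enc k x, desc k \<pi>]"
    have s: "s 0 = replicate k True" "s (Suc 0) = enc k x" "s 2 = desc k \<pi>"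
      by (auto simp: s_def store_of_def)
    define s1 where "s1 = s(3 := enc k (\<pi> x))"
    define s2 where "s2 = s1(4 := enc k (dec k (\<pi> x)))"
    define s3 where "s3 = s2(0 := enc k (inv \<pi> (dec k (\<pi> x))))"
    have kL: "k \<le> L" by (simp add: L_def)
    have poly_N: "poly N L = L + poly qe L" by (simp add: N_def)
    have poly_Q: "poly Q L = (1 + poly N L + poly q1 (poly N L)) +
        ((1 + poly N L + poly q2 (poly N L)) + (1 + poly N L + poly q3 (poly N L)))"
      by (simp add: Q_def poly_pcompose)
    have len: "length (enc k y) \<le> poly qe L" if "y \<in> M k" for y
      using qe[OF that] poly_nat_mono[OF kL, of qe] by (rule order_trans)
    have \<pi>x: "\<pi> x \<in> M k" and dx: "dec k (\<pi> x) \<in> M k" using F[OF \<pi> x] dec by auto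
    have le1: "k + (length (desc k \<pi>) + length (enc k x)) \<le> poly N L"
      unfolding poly_N by (simp add: L_def)
    have le2: "k + length (enc k (\<pi> x)) \<le> poly N L"
      using len[OF \<pi>x] unfolding poly_N by (simp add: L_def)
    have le3: "k + (length (desc k \<pi>) + length (enc k (dec k (\<pi> x)))) \<le> poly N L"
      using len[OF dx] unfolding poly_N by (simp add: L_def)
    \<comment> \<open>The calls are deterministic; a trivial draw from \<open>return_pmf ()\<close>
      puts them into the form that the composition rules expect.\<close>
    have step1: "reaches (Call 3 [0, 2, 1] c1) s (map_pmf (\<lambda>_. s1) (return_pmf ()))
        (1 + poly N L + poly q1 (poly N L))"
      unfolding s1_def using le1 poly_nat_mono[OF le1, of q1] eval \<pi> x
      by (intro reaches_Call) (auto simp: s)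
    have step2: "reaches (Call 4 [0, 3] c2) s1 (map_pmf (\<lambda>_. s2) (return_pmf ()))
        (1 + poly N L + poly q2 (poly N L))"
      unfolding s2_def using le2 poly_nat_mono[OF le2, of q2] decode \<pi>x
      by (intro reaches_Call) (auto simp: s s1_def)
    have step3: "reaches (Call 0 [0, 2, 4] c3) s2 (map_pmf (\<lambda>_. s3) (return_pmf ()))
        (1 + poly N L + poly q3 (poly N L))"
      unfolding s3_def using le3 poly_nat_mono[OF le3, of q3] inverse \<pi> dx
      by (intro reaches_Call) (auto simp: s s1_def s2_def)
    have "reaches c s (return_pmf s3) (poly Q L)"
      using reaches_Seq[OF step1, OF reaches_Seq[OF step2, OF step3]]
      by (simp add: c_def poly_Q bind_return_pmf)
    then show "reaches c (store_of [replicate k True, enc k x, desc k \<pi>]) (return_pmf s3)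
        (poly Q (k + (length (enc k x) + length (desc k \<pi>))))"
      by (simp add: s_def L_def)
    show "return_pmf (enc k (inv \<pi> (dec k (\<pi> x)))) = map_pmf (\<lambda>s. s 0) (return_pmf s3)"
      by (simp add: s3_def)
  qed
  \<comment> \<open>Here \<open>v = desc k \<pi>\<close> for some \<pi> in \<open>F k\<close>, and
    injectivity makes \<open>inv_into\<close> return that \<pi>.\<close>
  then have "computes c [replicate k True, enc k x, v]
      (map_pmf (enc k) (perm_Rec (F k) (desc k) (dec k) x v)) (poly Q (k + (length (enc k x) + length v)))"
    if "x \<in> M k" "v \<in> S k" for k x v
    using that S[of k] desc[of k] by (auto simp: perm_Rec_def)
  then show ?thesis
    unfolding efficient_iff by (intro exI[of _ c] exI[of _ Q]) auto
qed

text \<open>Polynomial time needs a size parameter, hence families indexed by \<open>k\<close>; the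
  sketch property is asserted for each \<open>k\<close> separately.\<close>

theorem lemma4p5:
  fixes M :: "nat \<Rightarrow> 'a set" and d :: "nat \<Rightarrow> 'a \<Rightarrow> 'a \<Rightarrow> real"
    and F :: "nat \<Rightarrow> ('a \<Rightarrow> 'a) set" and C :: "nat \<Rightarrow> 'a set"
    and K \<Gamma> :: "nat \<Rightarrow> nat" and t :: "nat \<Rightarrow> real"
    and desc :: "nat \<Rightarrow> ('a \<Rightarrow> 'a) \<Rightarrow> bool list" and dec :: "nat \<Rightarrow> 'a \<Rightarrow> 'a"
  assumes metric: "\<And>k. Metric_space (M k) (d k)"
    and finite_space: "\<And>k. finite (M k)"
    and integer_valued: "\<And>k x y. x \<in> M k \<Longrightarrow> y \<in> M k \<Longrightarrow> d k x y \<in> \<int>"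
    and isometries: "\<And>k. F k \<subseteq> isometries (M k) (d k)"
    and finite_family: "\<And>k. finite (F k)"
    and transitive: "\<And>k. acts_transitively (F k) (M k)"
    and code: "\<And>k. is_code (M k) (d k) (K k) (t k) (C k)"
    and code_nonempty: "\<And>k. K k > 0"
    and Gamma_pos: "\<And>k. \<Gamma> k > 0"
    and Gamma: "\<And>k w b. w \<in> M k \<Longrightarrow> b \<in> M k \<Longrightarrow> card {\<pi> \<in> F k. \<pi> w = b} \<ge> \<Gamma> k"
    and canonical: "\<And>k. inj_on (desc k) (F k)"
    and decoder: "\<And>k. nearest_codeword (M k) (d k) (C k) (dec k)"
  shows "(\<forall>k m. avg_secure_sketch (M k) (d k) m
              (m - log 2 (real (card (F k))) + log 2 (real (\<Gamma> k)) + log 2 (real (K k))) (t k)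
              (perm_SS (F k) (desc k) (C k)) (perm_Rec (F k) (desc k) (dec k))) \<and>
         (\<forall>enc. poly_encoding M enc \<longrightarrow>
            efficient_code_ops M enc C dec \<longrightarrow> efficient_perm_ops M enc C F desc \<longrightarrow>
            efficient_sketch M enc
              (\<lambda>k. perm_SS (F k) (desc k) (C k)) (\<lambda>k. perm_Rec (F k) (desc k) (dec k)))"
proof (intro conjI allI impI)
  fix k m
  show "avg_secure_sketch (M k) (d k) m
      (m - log 2 (real (card (F k))) + log 2 (real (\<Gamma> k)) + log 2 (real (K k))) (t k)
      (perm_SS (F k) (desc k) (C k)) (perm_Rec (F k) (desc k) (dec k))"
    by (rule avg_secure_sketch_perm[OF metric finite_space isometries finite_family code code_nonempty
          Gamma_pos Gamma canonical decoder])
next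
  fix enc
  assume enc: "poly_encoding M enc" and ops: "efficient_code_ops M enc C dec" "efficient_perm_ops M enc C F desc"
  have C: "C k \<subseteq> M k" "finite (C k)" "C k \<noteq> {}" for k
    using code[of k] code_nonempty[of k] finite_space[of k]
    by (auto simp: is_code_def intro: finite_subset)
  have F: "\<pi> x \<in> M k" if "\<pi> \<in> F k" "x \<in> M k" for k \<pi> x
    using isometries[of k] that by (auto simp: isometries_def permutes_in_image)
  have dec: "dec k x \<in> M k" if "x \<in> M k" for k x
    using decoder[of k] that C(1)[of k] by (auto simp: nearest_codeword_def is_arg_min_def)
  \<comment> \<open>This supplies the assumption on \<open>S\<close> in
    \<open>efficient_perm_Rec\<close>, with \<open>S k\<close> the set of all sketches of
    points.\<close>
  have "set_pmf (perm_SS (F k) (desc k) (C k) w) \<subseteq> desc k ` F k" if "w \<in> M k" for k w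
    using pmf_perm_SS_le(1)[OF finite_family canonical C(2,3) Gamma_pos Gamma] that C(1) by blast
  then show "efficient_sketch M enc
      (\<lambda>k. perm_SS (F k) (desc k) (C k)) (\<lambda>k. perm_Rec (F k) (desc k) (dec k))"
    unfolding efficient_sketch_def
    by (intro conjI efficient_perm_SS[OF enc ops C(2,3,1)]
        efficient_perm_Rec[where desc = desc and F = F, OF enc ops canonical]) (use dec F in auto)
qed

end
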